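(* The infinite cubic tree $T$ (the infinite 3-regular tree) satisfies $\mathrm{RED{:}IC}\%(T) = \tfrac{4}{7}$.
   Context: $N[v]$ denotes the closed neighborhood of $v$ and $\Delta$ symmetric difference. A set $S \subseteq V(G)$ is a redundant identifying code (RED:IC) if every vertex $v$ satisfies $|N[v] \cap S| \ge 2$ and every pair of distinct vertices $u,v$ satisfies $|(N[u]\cap S)\,\Delta\,(N[v]\cap S)| \ge 2$. For an infinite graph the density of $S$ is $\limsup_{r\to\infty} |S \cap B_r(v_0)|/|B_r(v_0)|$ for a fixed vertex $v_0$, where $B_r(v_0)$ is the set of vertices within distance $r$ of $v_0$; $\mathrm{RED{:}IC}\%(G)$ is the minimum (infimum) density of a RED:IC of $G$. *)

theory Defs
  imports Complex_Main "HOL-Library.Extended_Real"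
begin

text \<open>A graph has vertex set \<open>V\<close>, possibly infinite, and adjacency relation \<open>E\<close>; an undirected
  edge appears in \<open>E\<close> in both orientations.\<close>

definition simple_graph :: "'a set \<Rightarrow> ('a \<times> 'a) set \<Rightarrow> bool" where
  "simple_graph V E \<longleftrightarrow> E \<subseteq> V \<times> V \<and> sym E \<and> irrefl E"

definition connected_graph :: "'a set \<Rightarrow> ('a \<times> 'a) set \<Rightarrow> bool" where
  "connected_graph V E \<longleftrightarrow> V \<noteq> {} \<and> (\<forall>u\<in>V. \<forall>v\<in>V. (u, v) \<in> E\<^sup>*)"

definition graph_cycle :: "('a \<times> 'a) set \<Rightarrow> 'a list \<Rightarrow> bool" where
  "graph_cycle E c \<longleftrightarrow> length c \<ge> 3 \<and> distinct c
     \<and> (\<forall>i. Suc i < length c \<longrightarrow> (c ! i, c ! Suc i) \<in> E) \<and> (last c, hd c) \<in> E"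

definition tree :: "'a set \<Rightarrow> ('a \<times> 'a) set \<Rightarrow> bool" where
  "tree V E \<longleftrightarrow> simple_graph V E \<and> connected_graph V E \<and> (\<nexists>c. graph_cycle E c)"

definition regular :: "nat \<Rightarrow> 'a set \<Rightarrow> ('a \<times> 'a) set \<Rightarrow> bool" where
  "regular d V E \<longleftrightarrow> (\<forall>v\<in>V. finite (E `` {v}) \<and> card (E `` {v}) = d)"

text \<open>A finite tree has a vertex of degree at most 1, so \<open>V\<close> is infinite here; the cubic tree is
  unique up to isomorphism.\<close>

definition cubic_tree :: "'a set \<Rightarrow> ('a \<times> 'a) set \<Rightarrow> bool" where
  "cubic_tree V E \<longleftrightarrow> tree V E \<and> regular 3 V E"

definition closed_nbhd :: "('a \<times> 'a) set \<Rightarrow> 'a \<Rightarrow> 'a set" where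
  "closed_nbhd E v = insert v (E `` {v})"

text \<open>Meant for locally finite graphs: \<open>card\<close> of an infinite set is 0.\<close>

definition red_ic :: "'a set \<Rightarrow> ('a \<times> 'a) set \<Rightarrow> 'a set \<Rightarrow> bool" where
  "red_ic V E S \<longleftrightarrow> S \<subseteq> V
     \<and> (\<forall>v\<in>V. card (closed_nbhd E v \<inter> S) \<ge> 2)
     \<and> (\<forall>u\<in>V. \<forall>v\<in>V. u \<noteq> v \<longrightarrow>
          card (sym_diff (closed_nbhd E u \<inter> S) (closed_nbhd E v \<inter> S)) \<ge> 2)"

text \<open>The distance is the least length of a walk, and \<open>\<infinity>\<close> if there is none.\<close>

definition graph_dist :: "('a \<times> 'a) set \<Rightarrow> 'a \<Rightarrow> 'a \<Rightarrow> enat" where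
  "graph_dist E u v = Inf {enat n | n. (u, v) \<in> E ^^ n}"

definition graph_ball :: "'a set \<Rightarrow> ('a \<times> 'a) set \<Rightarrow> 'a \<Rightarrow> nat \<Rightarrow> 'a set" where
  "graph_ball V E v0 r = {v \<in> V. graph_dist E v0 v \<le> enat r}"

text \<open>Densities are \<open>ereal\<close>s because \<open>limsup\<close> needs a complete lattice.\<close>

definition upper_density :: "'a set \<Rightarrow> ('a \<times> 'a) set \<Rightarrow> 'a \<Rightarrow> 'a set \<Rightarrow> ereal" where
  "upper_density V E v0 S =
     limsup (\<lambda>r. ereal (real (card (S \<inter> graph_ball V E v0 r)) / real (card (graph_ball V E v0 r))))"

definition red_ic_density :: "'a set \<Rightarrow> ('a \<times> 'a) set \<Rightarrow> 'a \<Rightarrow> ereal" where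
  "red_ic_density V E v0 = (INF S\<in>{S. red_ic V E S}. upper_density V E v0 S)"

end

theory Submission
  imports Defs
begin

text \<open>In a tree, being a redundant identifying code only constrains the code degrees (the numbers of
  neighbours in the code): they are at least 1 in the code and at least 2 outside it, and they sum
  to at least 4 along each edge of the code. Equivalently, a leaf of a component of the code hangs
  on a vertex of code degree 3, and the sparsest such codes consist of stars with three leaves.

  Half of a ball lies on its boundary sphere, so discharging does not directly bound the ball
  densities. It does work for the weights \<open>1 / 2 ^ level\<close>, which satisfy the mean value property
  away from the root and give all levels the same total weight; an upper density below \<open>4 / 7\<close>
  would contradict the resulting bound on averages over levels.

  For the upper bound, the code made of stars is generated from the root by a finite automaton.
  Its transfer operator, restricted to the deviation from density \<open>4 / 7\<close>, grows more slowly than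
  the spheres, so the ball densities converge.\<close>

section \<open>Acyclicity\<close>

text \<open>If the new start vertex already occurs on the path, only the suffix from that occurrence
  is kept. The bound on \<open>set p\<close> later shows that the path misses a deleted
  vertex.\<close>

lemma rtrancl_simple_path:
  assumes "(a, b) \<in> R\<^sup>*"
  obtains p where "p \<noteq> []" "hd p = a" "last p = b" "distinct p"
    "successively (\<lambda>x y. (x, y) \<in> R) p" "set p \<subseteq> insert a (Range R)"
proof -
  have "\<exists>p. p \<noteq> [] \<and> hd p = a \<and> last p = b \<and> distinct p
      \<and> successively (\<lambda>x y. (x, y) \<in> R) p \<and> set p \<subseteq> insert a (Range R)"
    using assms
  proof (induction rule: converse_rtrancl_induct)
    case base
    show ?case by (intro exI[of _ "[b]"]) simp
  next
    case (step a y)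
    then obtain p where p: "p \<noteq> []" "hd p = y" "last p = b" "distinct p"
      "successively (\<lambda>x y. (x, y) \<in> R) p" "set p \<subseteq> insert y (Range R)"
      by blast
    have sub: "set p \<subseteq> Range R" using p(6) step(1) by blast
    show ?case
    proof (cases "a \<in> set p")
      case False
      then show ?thesis using p sub step(1)
        by (intro exI[of _ "a # p"]) (auto simp: successively_Cons)
    next
      case True
      then obtain xs ys where xy: "p = xs @ a # ys" by (meson split_list)
      show ?thesis using p(3,4,5) sub
        by (intro exI[of _ "a # ys"]) (auto simp: xy successively_append_iff)
    qed
  qed
  then show thesis using that by blast
qed

text \<open>A walk from \<open>p\<close> to \<open>q\<close> avoiding \<open>x\<close>, made simple,
  would close up through \<open>x\<close> to a cycle. So distinct neighbours of \<open>x\<close>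
  fall into different components when \<open>x\<close> is deleted.\<close>

lemma tree_no_detour:
  assumes "tree V E" "(x, p) \<in> E" "(x, q) \<in> E" "p \<noteq> q"
  shows "(p, q) \<notin> (E \<inter> (- {x}) \<times> (- {x}))\<^sup>*"
proof
  assume "(p, q) \<in> (E \<inter> (- {x}) \<times> (- {x}))\<^sup>*"
  then obtain c where c: "c \<noteq> []" "hd c = p" "last c = q" "distinct c"
    "successively (\<lambda>y z. (y, z) \<in> E \<inter> (- {x}) \<times> (- {x})) c"
    "set c \<subseteq> insert p (Range (E \<inter> (- {x}) \<times> (- {x})))"
    by (rule rtrancl_simple_path)
  have E: "sym E" "irrefl E" "\<nexists>c. graph_cycle E c"
    using assms(1) by (auto simp: tree_def simple_graph_def)
  have "p \<noteq> x" using assms(2) E(2) by (auto simp: irrefl_def)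
  then have x: "x \<notin> set c" using c(6) by blast
  have "length c \<noteq> 1"
    using c(2,3) assms(4) by (auto simp: length_Suc_conv)
  moreover have "length c \<noteq> 0" using c(1) by simp
  ultimately have len: "length c \<ge> 2" by linarith
  have "successively (\<lambda>y z. (y, z) \<in> E) (x # c)"
    using c(1,2,5) assms(2) by (auto simp: successively_Cons intro: successively_mono)
  moreover have "(q, x) \<in> E" using E(1) assms(3) by (auto dest: symD)
  ultimately have "graph_cycle E (x # c)"
    using x c len by (auto simp: graph_cycle_def successively_conv_nth)
  then show False using E(3) by blast
qed

section \<open>Redundant identifying codes in trees\<close>

text \<open>Adjacent vertices have no common neighbour, so the symmetric difference counts their
  other code neighbours; domination makes it at least 2 unless both lie in \<open>S\<close>.
  Nonadjacent vertices share at most one neighbour, since two would give a 4-cycle, so domination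
  already separates them.\<close>

lemma red_ic_iff_local:
  assumes tree: "tree V E" and fin: "\<forall>v\<in>V. finite (E `` {v})"
  shows "red_ic V E S \<longleftrightarrow> S \<subseteq> V
    \<and> (\<forall>v\<in>V. of_bool (v \<in> S) + card (E `` {v} \<inter> S) \<ge> 2)
    \<and> (\<forall>u\<in>S. \<forall>v\<in>S. (u, v) \<in> E \<longrightarrow> card (E `` {u} \<inter> S) + card (E `` {v} \<inter> S) \<ge> 4)"
proof -
  have E: "E \<subseteq> V \<times> V" "sym E" "irrefl E" "\<And>x. (x, x) \<notin> E"
    using tree by (auto simp: tree_def simple_graph_def irrefl_def)
  note symE = symD[OF E(2)]
  have dom: "card (closed_nbhd E v \<inter> S) = of_bool (v \<in> S) + card (E `` {v} \<inter> S)"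
    if "v \<in> V" for v
    using fin that E(4)[of v] by (auto simp: closed_nbhd_def card_insert_if)
  have adj: "card (sym_diff (closed_nbhd E u \<inter> S) (closed_nbhd E v \<inter> S)) =
      card (E `` {u} \<inter> S - {v}) + card (E `` {v} \<inter> S - {u})" if uv: "(u, v) \<in> E" for u v
  proof -
    have tri: False if "(u, w) \<in> E" "(v, w) \<in> E" for w
    proof -
      have "(w, v) \<in> E \<inter> (- {u}) \<times> (- {u})"
        using that uv E(4) symE by blast
      then show False using tree_no_detour[OF tree \<open>(u, w) \<in> E\<close> uv] that E(4)
        by blast
    qed
    have vu: "(v, u) \<in> E" "u \<noteq> v" using uv symE E(4) by blast+
    have "sym_diff (closed_nbhd E u \<inter> S) (closed_nbhd E v \<inter> S) =
        (E `` {u} \<inter> S - {v}) \<union> (E `` {v} \<inter> S - {u})"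
      using uv vu tri E(4) by (auto simp: closed_nbhd_def)
    moreover have "(E `` {u} \<inter> S - {v}) \<inter> (E `` {v} \<inter> S - {u}) = {}"
      using tri by blast
    moreover have "finite (E `` {u})" "finite (E `` {v})" using fin uv E(1) by blast+
    ultimately show ?thesis by (simp add: card_Un_disjoint)
  qed
  have adj_S: "card (E `` {u} \<inter> S) = of_bool (v \<in> S) + card (E `` {u} \<inter> S - {v})"
    if uv: "(u, v) \<in> E" for u v
  proof -
    have "finite (E `` {u} \<inter> S)" using fin uv E(1) by blast
    then have "v \<in> S \<Longrightarrow> card (E `` {u} \<inter> S) = Suc (card (E `` {u} \<inter> S - {v}))"
      using uv by (intro card.remove) auto
    then show ?thesis by auto
  qed
  have nonadj: "card (sym_diff (closed_nbhd E u \<inter> S) (closed_nbhd E v \<inter> S)) \<ge> 2"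
    if "u \<in> V" "v \<in> V" "u \<noteq> v" "(u, v) \<notin> E"
      "card (closed_nbhd E u \<inter> S) \<ge> 2" "card (closed_nbhd E v \<inter> S) \<ge> 2" for u v
  proof -
    let ?A = "closed_nbhd E u \<inter> S" and ?B = "closed_nbhd E v \<inter> S"
    have f: "finite ?A" "finite ?B" using fin that by (auto simp: closed_nbhd_def)
    have one: "x = y" if xy: "x \<in> ?A \<inter> ?B" "y \<in> ?A \<inter> ?B" for x y
    proof (rule ccontr)
      assume ne: "x \<noteq> y"
      have nb: "(u, x) \<in> E" "(u, y) \<in> E" "(v, x) \<in> E" "(v, y) \<in> E"
        using xy \<open>u \<noteq> v\<close> \<open>(u, v) \<notin> E\<close> symE by (auto simp: closed_nbhd_def)
      then have "(x, v) \<in> E \<inter> (- {u}) \<times> (- {u})" "(v, y) \<in> E \<inter> (- {u}) \<times> (- {u})"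
        using \<open>u \<noteq> v\<close> E(4) symE by blast+
      then have "(x, y) \<in> (E \<inter> (- {u}) \<times> (- {u}))\<^sup>*" by (meson rtrancl.simps)
      then show False using tree_no_detour[OF tree nb(1,2) ne] by blast
    qed
    have "\<not> card (?A \<inter> ?B) \<ge> 2"
    proof
      assume "card (?A \<inter> ?B) \<ge> 2"
      then obtain C where "C \<subseteq> ?A \<inter> ?B" "card C = 2" by (meson obtain_subset_with_card_n)
      then show False using one by (auto simp: card_2_iff)
    qed
    then have i: "card (?A \<inter> ?B) \<le> 1" by simp
    have "card (?A - ?B) \<ge> 1" "card (?B - ?A) \<ge> 1"
      using i that(5,6) f card_Diff_subset_Int[of ?A ?B] card_Diff_subset_Int[of ?B ?A]
      by (auto simp: Int_commute)
    moreover have "card (sym_diff ?A ?B) = card (?A - ?B) + card (?B - ?A)"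
      using f by (intro card_Un_disjoint) auto
    ultimately show ?thesis by linarith
  qed
  show ?thesis
  proof
    assume R: "red_ic V E S"
    then have S: "S \<subseteq> V" and d: "\<And>v. v \<in> V \<Longrightarrow> card (closed_nbhd E v \<inter> S) \<ge> 2"
      and s: "\<And>u v. u \<in> V \<Longrightarrow> v \<in> V \<Longrightarrow> u \<noteq> v \<Longrightarrow>
        card (sym_diff (closed_nbhd E u \<inter> S) (closed_nbhd E v \<inter> S)) \<ge> 2"
      by (auto simp: red_ic_def)
    have "card (E `` {u} \<inter> S) + card (E `` {v} \<inter> S) \<ge> 4"
      if "u \<in> S" "v \<in> S" "(u, v) \<in> E" for u v
    proof -
      have vu: "(v, u) \<in> E" "u \<noteq> v" "u \<in> V" "v \<in> V" using that symE E(1,4) by blast+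
      show ?thesis
        using s[OF vu(3,4,2)] adj[OF that(3)] adj_S[OF that(3)] adj_S[OF vu(1)] that(1,2)
        by simp
    qed
    then show "S \<subseteq> V \<and> (\<forall>v\<in>V. of_bool (v \<in> S) + card (E `` {v} \<inter> S) \<ge> 2)
    \<and> (\<forall>u\<in>S. \<forall>v\<in>S. (u, v) \<in> E \<longrightarrow> card (E `` {u} \<inter> S) + card (E `` {v} \<inter> S) \<ge> 4)"
      using S d dom by metis
  next
    assume R: "S \<subseteq> V \<and> (\<forall>v\<in>V. of_bool (v \<in> S) + card (E `` {v} \<inter> S) \<ge> 2)
    \<and> (\<forall>u\<in>S. \<forall>v\<in>S. (u, v) \<in> E \<longrightarrow> card (E `` {u} \<inter> S) + card (E `` {v} \<inter> S) \<ge> 4)"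
    have d: "card (closed_nbhd E v \<inter> S) \<ge> 2" if "v \<in> V" for v
      using R dom that by metis
    have "card (sym_diff (closed_nbhd E u \<inter> S) (closed_nbhd E v \<inter> S)) \<ge> 2"
      if uv: "u \<in> V" "v \<in> V" "u \<noteq> v" for u v
    proof (cases "(u, v) \<in> E")
      case False
      then show ?thesis using nonadj[OF uv] d[OF uv(1)] d[OF uv(2)] by blast
    next
      case True
      then have vu: "(v, u) \<in> E" using symE by blast
      have "of_bool (u \<in> S) + card (E `` {u} \<inter> S) \<ge> 2" "of_bool (v \<in> S) + card (E `` {v} \<inter> S) \<ge> 2"
        "u \<in> S \<Longrightarrow> v \<in> S \<Longrightarrow> card (E `` {u} \<inter> S) + card (E `` {v} \<inter> S) \<ge> 4"
        using R uv True by blast+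
      then show ?thesis
        unfolding adj[OF True] adj_S[OF True] adj_S[OF vu]
        by (cases "u \<in> S"; cases "v \<in> S"; simp only: of_bool_eq; linarith)
    qed
    then show "red_ic V E S" using R d by (simp add: red_ic_def)
  qed
qed

section \<open>The levels of a rooted cubic tree\<close>

locale rooted_cubic_tree =
  fixes V :: "'a set" and E :: "('a \<times> 'a) set" and v0 :: 'a
  assumes cubic: "cubic_tree V E" and root: "v0 \<in> V"
begin

lemma tree: "tree V E" and regular: "regular 3 V E"
  using cubic by (auto simp: cubic_tree_def)

lemma edge_V: "(u, v) \<in> E \<Longrightarrow> u \<in> V \<and> v \<in> V"
  and edge_sym: "(u, v) \<in> E \<Longrightarrow> (v, u) \<in> E"
  and no_loop: "(v, v) \<notin> E"
  using tree by (auto simp: tree_def simple_graph_def irrefl_def dest: symD)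

lemma locally_finite: "\<forall>v\<in>V. finite (E `` {v})"
  and finite_nbhd: "v \<in> V \<Longrightarrow> finite (E `` {v})"
  and card_nbhd: "v \<in> V \<Longrightarrow> card (E `` {v}) = 3"
  using regular by (auto simp: regular_def)

definition level :: "'a \<Rightarrow> nat" where
  "level v = (LEAST n. (v0, v) \<in> E ^^ n)"

definition sphere :: "nat \<Rightarrow> 'a set" where
  "sphere n = {v \<in> V. level v = n}"

lemma walk_level: "v \<in> V \<Longrightarrow> (v0, v) \<in> E ^^ level v"
proof -
  assume "v \<in> V"
  then have "(v0, v) \<in> E\<^sup>*" using tree root by (auto simp: tree_def connected_graph_def)
  then obtain n where "(v0, v) \<in> E ^^ n" by (meson rtrancl_imp_relpow)
  then show ?thesis unfolding level_def by (rule LeastI)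
qed

lemma level_le: "(v0, v) \<in> E ^^ n \<Longrightarrow> level v \<le> n"
  unfolding level_def by (rule Least_le)

lemma graph_dist_eq_level:
  assumes "v \<in> V" shows "graph_dist E v0 v = enat (level v)"
  unfolding graph_dist_def
proof (rule antisym)
  show "Inf {enat n |n. (v0, v) \<in> E ^^ n} \<le> enat (level v)"
    using walk_level[OF assms] by (intro Inf_lower) auto
  show "enat (level v) \<le> Inf {enat n |n. (v0, v) \<in> E ^^ n}"
    by (intro Inf_greatest) (auto intro: level_le)
qed

lemma level_root [simp]: "level v0 = 0"
  using level_le[of v0 0] by simp

lemma level_eq_0: "v \<in> V \<Longrightarrow> level v = 0 \<longleftrightarrow> v = v0"
  using walk_level[of v] by auto

lemma sphere_0: "sphere 0 = {v0}"
  using root level_eq_0 by (auto simp: sphere_def)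

lemma level_edge: "(u, v) \<in> E \<Longrightarrow> level v \<le> Suc (level u)"
  using walk_level[of u] edge_V by (intro level_le) auto

lemma ex_parent:
  assumes "v \<in> V" "v \<noteq> v0"
  shows "\<exists>u. (u, v) \<in> E \<and> Suc (level u) = level v"
proof -
  obtain n where n: "level v = Suc n"
    using level_eq_0[OF assms(1)] assms(2) by (cases "level v") auto
  then have "(v0, v) \<in> E ^^ Suc n" using walk_level[OF assms(1)] by simp
  then obtain u where u: "(v0, u) \<in> E ^^ n" "(u, v) \<in> E" by auto
  then have "level u \<le> n" by (blast intro: level_le)
  then have "Suc (level u) = level v" using level_edge[OF u(2)] n by linarith
  then show ?thesis using u(2) by blast
qed

text \<open>A shortest route to the root drops one level per step, so after leaving \<open>u\<close>
  it stays below the level of \<open>x\<close> and cannot meet \<open>x\<close>.\<close>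

lemma descend:
  assumes "u \<in> V" "u \<noteq> x" "level u \<le> level x"
  shows "(u, v0) \<in> (E \<inter> (- {x}) \<times> (- {x}))\<^sup>*"
  using assms
proof (induction "level u" arbitrary: u)
  case 0
  then show ?case using level_eq_0 by auto
next
  case (Suc n)
  then obtain w where w: "(w, u) \<in> E" "Suc (level w) = level u"
    using ex_parent[of u] by force
  then have "w \<in> V" "w \<noteq> x" "level w \<le> level x" "n = level w"
    using Suc edge_V by auto
  then have "(w, v0) \<in> (E \<inter> (- {x}) \<times> (- {x}))\<^sup>*" by (intro Suc.hyps(1))
  moreover have "(u, w) \<in> E \<inter> (- {x}) \<times> (- {x})"
    using w(1) edge_sym \<open>w \<noteq> x\<close> Suc.prems(2) by blast
  ultimately show ?case by (rule converse_rtrancl_into_rtrancl[rotated])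
qed

text \<open>Two such neighbours would be joined through the root without \<open>x\<close>. The
  non-strict bounds also exclude edges inside a level.\<close>

lemma lower_nbr_unique:
  assumes "(x, p) \<in> E" "(x, q) \<in> E" "level p \<le> level x" "level q \<le> level x"
  shows "p = q"
proof (rule ccontr)
  assume ne: "p \<noteq> q"
  let ?R = "E \<inter> (- {x}) \<times> (- {x})"
  have "p \<in> V" "q \<in> V" "p \<noteq> x" "q \<noteq> x" using assms(1,2) edge_V no_loop by blast+
  then have "(p, v0) \<in> ?R\<^sup>*" "(q, v0) \<in> ?R\<^sup>*" using descend assms(3,4) by blast+
  moreover have "sym (?R\<^sup>*)" by (intro sym_rtrancl symI) (auto intro: edge_sym)
  ultimately have "(p, q) \<in> ?R\<^sup>*" by (meson rtrancl_trans symD)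
  then show False using tree_no_detour[OF tree assms(1,2) ne] by blast
qed

section \<open>Parents and children\<close>

definition parent :: "'a \<Rightarrow> 'a" where
  "parent v = (SOME u. (u, v) \<in> E \<and> Suc (level u) = level v)"

definition children :: "'a \<Rightarrow> 'a set" where
  "children v = {u. (v, u) \<in> E \<and> level u = Suc (level v)}"

lemma parent_edge: "v \<in> V \<Longrightarrow> v \<noteq> v0 \<Longrightarrow> (v, parent v) \<in> E"
  and level_parent: "v \<in> V \<Longrightarrow> v \<noteq> v0 \<Longrightarrow> Suc (level (parent v)) = level v"
proof -
  assume v: "v \<in> V" "v \<noteq> v0"
  have "(parent v, v) \<in> E \<and> Suc (level (parent v)) = level v"
    using someI_ex[OF ex_parent[OF v]] unfolding parent_def .
  then show "(v, parent v) \<in> E" "Suc (level (parent v)) = level v"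
    using edge_sym by auto
qed

lemma parent_eq: "u \<in> children v \<Longrightarrow> parent u = v"
proof -
  assume u: "u \<in> children v"
  then have e: "(u, v) \<in> E" "level v \<le> level u" "u \<in> V" "u \<noteq> v0"
    using edge_sym edge_V by (auto simp: children_def)
  show ?thesis
    using lower_nbr_unique[OF parent_edge[OF e(3,4)] e(1) _ e(2)] level_parent[OF e(3,4)]
    by linarith
qed

lemma nbhd_root: "E `` {v0} = children v0"
proof -
  have "level u = Suc 0" if "(v0, u) \<in> E" for u
    using level_edge[OF that] level_eq_0[of u] edge_V[OF that] that no_loop[of v0]
    by (cases "level u") auto
  then show ?thesis by (auto simp: children_def)
qed

lemma nbhd: "v \<in> V \<Longrightarrow> v \<noteq> v0 \<Longrightarrow> E `` {v} = insert (parent v) (children v)"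
proof -
  assume v: "v \<in> V" "v \<noteq> v0"
  have "level u = Suc (level v)" if "(v, u) \<in> E" "u \<noteq> parent v" for u
    using lower_nbr_unique[OF that(1) parent_edge[OF v]] level_parent[OF v] that level_edge[OF that(1)]
    by (cases "level u \<le> level v") auto
  then show ?thesis using parent_edge[OF v] by (auto simp: children_def)
qed

lemma finite_children: "v \<in> V \<Longrightarrow> finite (children v)"
  using finite_nbhd[of v] by (rule rev_finite_subset) (auto simp: children_def)

lemma parent_notin_children: "v \<in> V \<Longrightarrow> v \<noteq> v0 \<Longrightarrow> parent v \<notin> children v"
  using level_parent[of v] by (auto simp: children_def)

lemma card_children: "v \<in> V \<Longrightarrow> v \<noteq> v0 \<Longrightarrow> card (children v) = 2"
  using card_nbhd[of v] nbhd[of v] parent_notin_children[of v] finite_children[of v] by simp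

text \<open>An arbitrary order on siblings, which lets the automaton below treat them
  differently.\<close>

definition left :: "'a \<Rightarrow> 'a" where
  "left v = (SOME u. u \<in> children v)"

definition right :: "'a \<Rightarrow> 'a" where
  "right v = (SOME u. u \<in> children v - {left v})"

lemma children_eq: "v \<in> V \<Longrightarrow> v \<noteq> v0 \<Longrightarrow> children v = {left v, right v} \<and> left v \<noteq> right v"
proof -
  assume v: "v \<in> V" "v \<noteq> v0"
  obtain a b where ab: "children v = {a, b}" "a \<noteq> b"
    using card_children[OF v] by (auto simp: card_2_iff)
  have ex: "\<exists>u. u \<in> children v" "\<exists>u. u \<in> children v - {left v}" using ab by auto
  have "left v \<in> children v" "right v \<in> children v - {left v}"
    using someI_ex[OF ex(1), folded left_def] someI_ex[OF ex(2), folded right_def] by blast+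
  then show ?thesis using ab by auto
qed

lemma sum_nbhd:
  assumes "v \<in> V" "v \<noteq> v0"
  shows "sum f (E `` {v}) = f (parent v) + sum f (children v)"
  using nbhd[OF assms] finite_children[OF assms(1)] parent_notin_children[OF assms] by simp

section \<open>Sums over spheres\<close>

lemma sphere_V: "v \<in> sphere n \<Longrightarrow> v \<in> V"
  by (simp add: sphere_def)

lemma sphere_Suc: "sphere (Suc n) = (\<Union>v\<in>sphere n. children v)"
proof
  show "sphere (Suc n) \<subseteq> (\<Union>v\<in>sphere n. children v)"
  proof
    fix u assume "u \<in> sphere (Suc n)"
    then have u: "u \<in> V" "level u = Suc n" "u \<noteq> v0" by (auto simp: sphere_def)
    then have "parent u \<in> sphere n" "u \<in> children (parent u)"
      using parent_edge[OF u(1,3)] level_parent[OF u(1,3)] edge_V edge_sym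
      by (auto simp: sphere_def children_def)
    then show "u \<in> (\<Union>v\<in>sphere n. children v)" by blast
  qed
  show "(\<Union>v\<in>sphere n. children v) \<subseteq> sphere (Suc n)"
    using edge_V by (auto simp: sphere_def children_def)
qed

lemma finite_sphere: "finite (sphere n)"
  by (induction n) (auto simp: sphere_0 sphere_Suc finite_children dest: sphere_V)

lemma sum_sphere_Suc: "sum f (sphere (Suc n)) = (\<Sum>v\<in>sphere n. sum f (children v))"
  unfolding sphere_Suc
  by (rule sum.UNION_disjoint) (auto simp: finite_sphere finite_children sphere_V dest: parent_eq)

lemma sphere_Suc_not_root: "v \<in> sphere (Suc n) \<Longrightarrow> v \<noteq> v0"
  by (auto simp: sphere_def)

lemma card_sphere_Suc: "card (sphere (Suc n)) = 3 * 2 ^ n"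
proof (induction n)
  case 0
  show ?case using card_nbhd[OF root] nbhd_root by (simp add: sphere_Suc sphere_0)
next
  case (Suc n)
  have "card (sphere (Suc (Suc n))) = (\<Sum>v\<in>sphere (Suc n). card (children v))"
    using sum_sphere_Suc[of "\<lambda>_. 1 :: nat" "Suc n"] by simp
  also have "\<dots> = (\<Sum>v\<in>sphere (Suc n). 2)"
    by (intro sum.cong refl card_children) (auto dest: sphere_V sphere_Suc_not_root)
  finally show ?case using Suc by simp
qed

lemma sum_parent_sphere:
  fixes f :: "'a \<Rightarrow> real"
  shows "(\<Sum>v\<in>sphere (Suc (Suc n)). f (parent v)) = 2 * sum f (sphere (Suc n))"
proof -
  have "(\<Sum>v\<in>sphere (Suc (Suc n)). f (parent v)) = (\<Sum>v\<in>sphere (Suc n). \<Sum>u\<in>children v. f (parent u))"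
    by (rule sum_sphere_Suc)
  also have "\<dots> = (\<Sum>v\<in>sphere (Suc n). 2 * f v)"
    by (intro sum.cong refl)
      (simp add: parent_eq card_children[OF sphere_V sphere_Suc_not_root])
  finally show ?thesis by (simp add: sum_distrib_left)
qed

section \<open>Balls and the excess over density 4/7\<close>

abbreviation ball :: "nat \<Rightarrow> 'a set" where
  "ball \<equiv> graph_ball V E v0"

lemma ball_eq: "ball r = (\<Union>n\<le>r. sphere n)"
  using graph_dist_eq_level by (auto simp: graph_ball_def sphere_def)

lemma finite_ball: "finite (ball r)"
  unfolding ball_eq using finite_sphere by simp

lemma sum_ball: "sum f (ball r) = (\<Sum>n\<le>r. sum f (sphere n))"
  unfolding ball_eq
  by (rule sum.UNION_disjoint) (use finite_sphere in \<open>auto simp: sphere_def\<close>)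

lemma card_ball: "real (card (ball r)) = 3 * 2 ^ r - 2"
proof -
  have "real (card (ball r)) = (\<Sum>n\<le>r. real (card (sphere n)))"
    using sum_ball[of "\<lambda>_. 1 :: real"] by simp
  also have "\<dots> = 3 * 2 ^ r - 2"
    by (induction r) (simp_all add: sphere_0 card_sphere_Suc)
  finally show ?thesis .
qed

lemma card_ball_bounds: "2 ^ r \<le> real (card (ball r))" "real (card (ball r)) \<le> 3 * 2 ^ r"
  using one_le_power[of "2 :: real" r] by (simp_all add: card_ball)

text \<open>Seven times the deviation of the indicator of \<open>S\<close> from 4/7.\<close>

definition excess :: "'a set \<Rightarrow> 'a \<Rightarrow> real" where
  "excess S v = (if v \<in> S then 3 else - 4)"

lemma sum_excess_ball:
  "sum (excess S) (ball r) = 7 * real (card (S \<inter> ball r)) - 4 * real (card (ball r))"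
proof -
  have "excess S v = 7 * of_bool (v \<in> S) - 4" for v by (simp add: excess_def)
  then have "sum (excess S) (ball r) = 7 * (\<Sum>v\<in>ball r. of_bool (v \<in> S)) - 4 * real (card (ball r))"
    by (simp add: sum_subtractf sum_distrib_left)
  then show ?thesis using finite_ball by (simp add: Int_commute)
qed

lemma sum_excess_ball_le: "sum (excess S) (ball r) \<le> 9 * 2 ^ r"
proof -
  have "sum (excess S) (ball r) \<le> 3 * real (card (ball r))"
    using sum_bounded_above[of "ball r" "excess S" 3] by (simp add: excess_def mult.commute)
  then show ?thesis using card_ball_bounds(2)[of r] by linarith
qed

section \<open>The lower bound\<close>

text \<open>A discharging rule in potential form: each neighbour \<open>u\<close> of
  \<open>v\<close> sends it \<open>potential S u - potential S v\<close>. Outside vertices receive 2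
  from each code neighbour, and code vertices of code degree 3 pay 1 to each neighbour of smaller
  code degree.\<close>

definition potential :: "'a set \<Rightarrow> 'a \<Rightarrow> real" where
  "potential S v = 2 * of_bool (v \<in> S) + of_bool (v \<in> S \<and> card (E `` {v} \<inter> S) = 3)"

text \<open>No charge is negative after discharging. Equality holds on stars with three leaves and
  at outside vertices with two code neighbours, so the rule is tight for the extremal codes.\<close>

lemma excess_ge_laplacian:
  assumes S: "red_ic V E S" and v: "v \<in> V"
  shows "excess S v \<ge> 3 * potential S v - sum (potential S) (E `` {v})"
proof -
  let ?k = "\<lambda>v. card (E `` {v} \<inter> S)"
  note S' = S[unfolded red_ic_iff_local[OF tree locally_finite]]
  have fin: "finite (E `` {v})" using finite_nbhd v .
  have kle: "?k u \<le> 3" if "u \<in> V" for u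
    using card_nbhd[OF that] card_mono[OF finite_nbhd[OF that], of "E `` {u} \<inter> S"] by simp
  define c where "c = card (E `` {v} \<inter> {u. u \<in> S \<and> ?k u = 3})"
  have sum: "sum (potential S) (E `` {v}) = 2 * real (?k v) + real c"
    using fin by (simp add: potential_def sum.distrib sum_distrib_left[symmetric] c_def)
  have k2: "of_bool (v \<in> S) + ?k v \<ge> 2" using S' v by blast
  show ?thesis
  proof (cases "v \<in> S")
    case False
    then show ?thesis using k2 by (simp add: sum excess_def potential_def[of S v])
  next
    case True
    then consider "?k v = 1" | "?k v = 2" | "?k v = 3" using k2 kle[OF v] by fastforce
    then show ?thesis
    proof cases
      case 1
      then obtain u where u: "(v, u) \<in> E" "u \<in> S"
        by (metis Image_singleton_iff Int_iff card_1_singletonE singletonI)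
      then have "?k v + ?k u \<ge> 4" using S' True by blast
      then have "?k u = 3" using 1 kle[of u] edge_V[OF u(1)] by simp
      then have "c \<noteq> 0" unfolding c_def using u fin by auto
      then show ?thesis using 1 True by (simp add: sum excess_def potential_def[of S v])
    qed (use True in \<open>simp_all add: sum excess_def potential_def[of S v]\<close>)
  qed
qed

text \<open>The function \<open>v \<mapsto> 1 / 2 ^ level v\<close> has neighbour sums \<open>3\<close> times its value away from the
  root, so the Laplacian of the potential telescopes under these weights.\<close>

lemma weighted_excess_ge:
  assumes S: "red_ic V E S"
  shows "(\<Sum>n\<le>R. sum (excess S) (sphere n) / 2 ^ n) \<ge> - 9"
proof -
  define G where "G n = sum (potential S) (sphere n)" for n
  have pot: "0 \<le> potential S v" "potential S v \<le> 3" for v by (auto simp: potential_def)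
  have G0: "G n \<ge> 0" for n unfolding G_def by (intro sum_nonneg pot)
  have GSuc: "G (Suc n) \<le> 9 * 2 ^ n" for n
    using sum_bounded_above[of "sphere (Suc n)" "potential S" 3] pot(2)
    by (simp add: G_def card_sphere_Suc)
  define N where "N n = (\<Sum>v\<in>sphere n. sum (potential S) (E `` {v}))" for n
  have level: "sum (excess S) (sphere n) \<ge> 3 * G n - N n" for n
    unfolding G_def N_def sum_distrib_left sum_subtractf[symmetric]
    by (intro sum_mono excess_ge_laplacian S) (rule sphere_V)
  have N0: "N 0 = G 1"
    by (simp add: N_def G_def sphere_0 sphere_Suc nbhd_root)
  have NSuc: "N (Suc n) = (\<Sum>v\<in>sphere (Suc n). potential S (parent v)) + G (Suc (Suc n))" for n
    unfolding N_def G_def sum_sphere_Suc[of _ "Suc n"] sum.distrib[symmetric]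
    by (intro sum.cong refl sum_nbhd) (auto dest: sphere_V sphere_Suc_not_root)
  \<comment> \<open>All three vertices of level 1 have the root as parent: factor 3 here, 2 further
    out.\<close>
  have "(\<Sum>v\<in>sphere (Suc 0). potential S (parent v)) = (\<Sum>v\<in>sphere (Suc 0). potential S v0)"
    by (intro sum.cong refl) (simp add: sphere_Suc sphere_0 parent_eq)
  then have N1: "N (Suc 0) = 3 * G 0 + G 2"
    by (simp add: NSuc card_sphere_Suc G_def sphere_0 numeral_2_eq_2)
  have N2: "N (Suc (Suc n)) = 2 * G (Suc n) + G (Suc (Suc (Suc n)))" for n
    by (simp add: NSuc sum_parent_sphere) (simp add: G_def)
  define X where "X R = (\<Sum>n\<le>R. sum (excess S) (sphere n) / 2 ^ n)" for R
  have X_Suc: "X (Suc R) \<ge> 3 / 2 * G 0 + G (Suc R) / 2 ^ Suc R - 2 * (G (Suc (Suc R)) / 2 ^ Suc (Suc R))" for R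
  \<comment> \<open>For n at least 1, \<open>G n / 2 ^ n\<close> enters with coefficient 3 from
    level n, -1 from level n + 1 and -2 from level n - 1. These cancel, leaving terms at the root
    and at the outer edge only.\<close>
  proof (induction R)
    case 0
    show ?case using level[of 0] level[of 1] N0 N1 by (simp add: X_def numeral_2_eq_2)
  next
    case (Suc R)
    have X: "X (Suc (Suc R)) = X (Suc R) + sum (excess S) (sphere (Suc (Suc R))) / 2 ^ Suc (Suc R)"
      by (simp add: X_def)
    have "sum (excess S) (sphere (Suc (Suc R))) / 2 ^ Suc (Suc R) \<ge>
        (3 * G (Suc (Suc R)) - 2 * G (Suc R) - G (Suc (Suc (Suc R)))) / 2 ^ Suc (Suc R)"
      using level[of "Suc (Suc R)"] N2[of R] by (intro divide_right_mono) auto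
    then have "sum (excess S) (sphere (Suc (Suc R))) / 2 ^ Suc (Suc R) \<ge>
        3 * (G (Suc (Suc R)) / 2 ^ Suc (Suc R)) - G (Suc R) / 2 ^ Suc R
        - 2 * (G (Suc (Suc (Suc R))) / 2 ^ Suc (Suc (Suc R)))"
      by (simp add: diff_divide_distrib)
    then show ?case using Suc X by linarith
  qed
  have "X R \<ge> - 2 * (G (Suc R) / 2 ^ Suc R)"
  proof (cases R)
    case 0
    then show ?thesis using level[of 0] N0 G0[of 0] by (simp add: X_def)
  next
    case (Suc r)
    have "G (Suc r) / 2 ^ Suc r \<ge> 0" by (intro divide_nonneg_nonneg G0) simp
    then show ?thesis using X_Suc[of r] G0[of 0] unfolding Suc by linarith
  qed
  \<comment> \<open>Level \<open>Suc R\<close> has \<open>3 * 2 ^ R\<close> vertices of potential at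
    most 3; doubling gives the 9 of the claim.\<close>
  moreover have "G (Suc R) / 2 ^ Suc R \<le> 9 / 2" using GSuc[of R] by (simp add: field_simps)
  ultimately show ?thesis unfolding X_def by simp
qed

text \<open>The sphere of radius n lies in the balls of radius n up to \<open>R\<close>, whose
  weights add up to \<open>2 / 2 ^ n - 1 / 2 ^ R\<close>.\<close>

lemma sum_weighted_balls:
  fixes f :: "'a \<Rightarrow> real"
  shows "(\<Sum>r\<le>R. sum f (ball r) / 2 ^ r) =
    2 * (\<Sum>n\<le>R. sum f (sphere n) / 2 ^ n) - sum f (ball R) / 2 ^ R"
proof (induction R)
  case 0
  show ?case by (simp add: sum_ball)
next
  case (Suc R)
  have step: "x + a = 2 * (y + c) - a" if "a = b + c" "d = 2 * b" "x = 2 * y - d"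
    for a b c d x y :: real
    using that by simp
  show ?case unfolding sum.atMost_Suc
    by (rule step[where b = "sum f (ball R) / 2 ^ Suc R", OF _ _ Suc])
      (simp_all add: sum_ball add_divide_distrib)
qed

text \<open>Weighting the ball of radius \<open>r\<close> by \<open>1 / 2 ^ r\<close> turns the bounded weighted excess into a
  statement about an average of the ball densities.\<close>

lemma upper_density_ge:
  assumes S: "red_ic V E S"
  shows "upper_density V E v0 S \<ge> ereal (4 / 7)"
proof (rule ccontr)
  assume "\<not> upper_density V E v0 S \<ge> ereal (4 / 7)"
  then obtain c where c: "upper_density V E v0 S < ereal c" "ereal c < ereal (4 / 7)"
    by (meson ereal_dense2 not_le)
  then have "\<forall>\<^sub>F r in sequentially. ereal (real (card (S \<inter> ball r)) / real (card (ball r))) < ereal c"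
    unfolding upper_density_def by (intro Limsup_lessD)
  then obtain r0 where r0: "\<And>r. r \<ge> r0 \<Longrightarrow> real (card (S \<inter> ball r)) / real (card (ball r)) < c"
    by (auto simp: eventually_sequentially)
  define \<delta> where "\<delta> = 4 - 7 * c"
  have \<delta>: "\<delta> > 0" using c(2) by (simp add: \<delta>_def)
  define Z where "Z R = (\<Sum>r\<le>R. sum (excess S) (ball r) / 2 ^ r)" for R
  \<comment> \<open>27 = 2 * 9 + 9: twice the bound over the spheres, and the last ball.\<close>
  have Z_ge: "Z R \<ge> - 27" for R
  proof -
    have "sum (excess S) (ball R) / 2 ^ R \<le> 9"
      using sum_excess_ball_le[of S R] by (simp add: field_simps)
    then show ?thesis
      using weighted_excess_ge[OF S, of R] by (simp add: Z_def sum_weighted_balls)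
  qed
  \<comment> \<open>A ball has at least \<open>2 ^ r\<close> vertices, so each radius from
    \<open>r0\<close> on lowers \<open>Z\<close> by at least \<open>\<delta>\<close>, and
    \<open>Z\<close> falls below any bound.\<close>
  have step: "sum (excess S) (ball r) / 2 ^ r \<le> - \<delta>" if "r \<ge> r0" for r
  proof -
    have pos: "0 < real (card (ball r))"
      using card_ball_bounds(1)[of r] by (meson less_le_trans zero_less_numeral zero_less_power)
    then have "real (card (S \<inter> ball r)) \<le> c * real (card (ball r))"
      using r0[OF that] by (simp add: field_simps)
    then have "sum (excess S) (ball r) \<le> - \<delta> * real (card (ball r))"
      by (simp add: sum_excess_ball \<delta>_def algebra_simps)
    also have "\<dots> \<le> - \<delta> * 2 ^ r" using card_ball_bounds(1)[of r] \<delta> by simp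
    finally show ?thesis by (simp add: field_simps)
  qed
  have Z_le: "Z (r0 + m) \<le> Z r0 - \<delta> * real m" for m
  proof (induction m)
    case (Suc m)
    then show ?case using step[of "Suc (r0 + m)"] by (simp add: Z_def algebra_simps)
  qed simp
  obtain m where "Z r0 + 27 < real m * \<delta>" using ex_less_of_nat_mult[OF \<delta>] by blast
  then show False using Z_le[of m] Z_ge[of "r0 + m"] by (simp add: mult.commute)
qed

end

section \<open>A code of density 4/7\<close>

text \<open>The code induces a disjoint union of stars with three leaves, and every vertex outside has
  exactly two neighbours in it. The label of a vertex records its role and that of its parent:
  the centre of a star; a leaf below its centre; a leaf above its centre; a vertex outside the code
  whose parent is in it; a vertex outside the code whose parent is outside as well.\<close>

datatype label = Center | Low_Leaf | High_Leaf | Out_In | Out_Out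

text \<open>The flag, true for the left child, matters only where siblings differ: a leaf above its
  centre has one centre among its children, and an outside vertex with its parent in the code needs
  just one more code neighbour.\<close>

fun child_label :: "label \<Rightarrow> bool \<Rightarrow> label" where
  "child_label Center b = Low_Leaf"
| "child_label Low_Leaf b = Out_In"
| "child_label High_Leaf b = (if b then Center else Out_In)"
| "child_label Out_In b = (if b then High_Leaf else Out_Out)"
| "child_label Out_Out b = High_Leaf"

fun in_code :: "label \<Rightarrow> bool" where
  "in_code Center = True"
| "in_code Low_Leaf = True"
| "in_code High_Leaf = True"
| "in_code Out_In = False"
| "in_code Out_Out = False"

fun code_degree :: "label \<Rightarrow> nat" where
  "code_degree Center = 3"
| "code_degree Low_Leaf = 1"
| "code_degree High_Leaf = 1"
| "code_degree Out_In = 2"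
| "code_degree Out_Out = 2"

text \<open>Generic in the value type: it counts code neighbours in \<open>nat\<close> and adds up
  excess in \<open>real\<close>.\<close>

definition transfer :: "(label \<Rightarrow> 'b :: plus) \<Rightarrow> label \<Rightarrow> 'b" where
  "transfer g l = g (child_label l True) + g (child_label l False)"

definition label_excess :: "label \<Rightarrow> real" where
  "label_excess l = (if in_code l then 3 else - 4)"

text \<open>The excess lies in an invariant subspace on which the characteristic polynomial of
  \<^const>\<open>transfer\<close> is \<open>x ^ 4 + 2 x\<^sup>3 + 3 x\<^sup>2 + 4 x + 4\<close>, and
  \<open>(x - 1)\<^sup>2 (x ^ 4 + 2 x\<^sup>3 + 3 x\<^sup>2 + 4 x + 4) = x ^ 6 - x\<^sup>2 - 4 x + 4\<close>.\<close>

lemma transfer_label_excess: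
  "(transfer ^^ 6) label_excess l =
    (transfer ^^ 2) label_excess l + 4 * transfer label_excess l - 4 * label_excess l"
  by (cases l) (simp_all add: numeral_eq_Suc transfer_def label_excess_def)

section \<open>Labelling the vertices\<close>

context rooted_cubic_tree
begin

text \<open>The level serves as the structural recursion argument while the vertex moves to its
  parent.\<close>

fun label_at :: "nat \<Rightarrow> 'a \<Rightarrow> label" where
  "label_at 0 v = Center"
| "label_at (Suc n) v = child_label (label_at n (parent v)) (v = left (parent v))"

definition label :: "'a \<Rightarrow> label" where
  "label v = label_at (level v) v"

definition code :: "'a set" where
  "code = {v \<in> V. in_code (label v)}"

lemma label_root: "label v0 = Center"
  by (simp add: label_def)

lemma label_child: "u \<in> children v \<Longrightarrow> label u = child_label (label v) (u = left v)"
  by (frule parent_eq) (simp add: label_def children_def)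

lemma child_parent: "v \<in> V \<Longrightarrow> v \<noteq> v0 \<Longrightarrow> v \<in> children (parent v)"
  using parent_edge edge_sym level_parent by (simp add: children_def)

lemma sum_children_label:
  assumes "v \<in> V" "v \<noteq> v0"
  shows "(\<Sum>u\<in>children v. g (label u)) = transfer g (label v)"
proof -
  have "left v \<in> children v" "right v \<in> children v" using children_eq[OF assms] by auto
  note this[THEN label_child]
  then show ?thesis
    using children_eq[OF assms] by (auto simp: transfer_def)
qed

lemma card_nbhd_code:
  assumes "v \<in> V"
  shows "card (E `` {v} \<inter> code) = code_degree (label v)"
proof -
  have "E `` {v} \<inter> code = E `` {v} \<inter> {u. in_code (label u)}"
    using edge_V by (auto simp: code_def)
  then have "card (E `` {v} \<inter> code) = (\<Sum>u\<in>E `` {v}. of_bool (in_code (label u)))"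
    using finite_nbhd[OF assms] by simp
  also have "\<dots> = code_degree (label v)"
  proof (cases "v = v0")
    case True
    have "in_code (label u)" if "u \<in> children v0" for u
      using label_child[OF that] by (simp add: label_root)
    then show ?thesis using True card_nbhd[OF root] by (simp add: nbhd_root label_root)
  next
    case False
    have "(\<Sum>u\<in>E `` {v}. of_bool (in_code (label u))) =
        of_bool (in_code (label (parent v))) + transfer (\<lambda>l. of_bool (in_code l) :: nat) (label v)"
      using sum_children_label[OF assms False, of "\<lambda>l. of_bool (in_code l) :: nat"]
      by (simp add: sum_nbhd[OF assms False])
    also have "\<dots> = code_degree (label v)"
      \<comment> \<open>The parent's label may vary for a given label of \<open>v\<close>, so all
        parent labels and flags are checked.\<close>
      unfolding label_child[OF child_parent[OF assms False]]
      by (cases "label (parent v)"; cases "v = left (parent v)") (simp_all add: transfer_def)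
    finally show ?thesis .
  qed
  finally show ?thesis .
qed

lemma red_ic_code: "red_ic V E code"
  unfolding red_ic_iff_local[OF tree locally_finite]
proof (intro conjI ballI impI)
  show "code \<subseteq> V" by (auto simp: code_def)
next
  fix v assume v: "v \<in> V"
  then have "v \<in> code \<longleftrightarrow> in_code (label v)" by (simp add: code_def)
  then show "2 \<le> of_bool (v \<in> code) + card (E `` {v} \<inter> code)"
    using v by (cases "label v") (simp_all add: card_nbhd_code)
next
  \<comment> \<open>Adjacent code vertices are always a centre and a leaf, of code degrees 3 and
    1.\<close>
  have par: "code_degree (label u) + code_degree (label v) \<ge> 4"
    if "v \<in> children u" "in_code (label u)" "in_code (label v)" for u v
    using that(2,3) unfolding label_child[OF that(1)]
    by (cases "label u"; cases "v = left u") simp_all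
  fix u v assume uv: "u \<in> code" "v \<in> code" "(u, v) \<in> E"
  then have V: "u \<in> V" "v \<in> V" by (auto simp: code_def)
  have "v \<in> children u \<or> u \<in> children v"
  proof (cases "u = v0")
    case True
    then show ?thesis using uv(3) nbhd_root by blast
  next
    case False
    then have "v = parent u \<or> v \<in> children u" using nbhd[OF V(1)] uv(3) by blast
    then show ?thesis using child_parent[OF V(1) False] by blast
  qed
  then have "code_degree (label u) + code_degree (label v) \<ge> 4"
    using par[of u v] par[of v u] uv(1,2) by (auto simp: code_def add.commute)
  then show "4 \<le> card (E `` {u} \<inter> code) + card (E `` {v} \<inter> code)"
    using V by (simp add: card_nbhd_code)
qed

section \<open>Growth of the excess of the code\<close>

lemma sum_sphere_transfer:
  "(\<Sum>v\<in>sphere (Suc n + m). g (label v)) = (\<Sum>v\<in>sphere (Suc n). (transfer ^^ m) g (label v))"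
proof (induction m arbitrary: g)
  case (Suc m)
  have "(\<Sum>v\<in>sphere (Suc n + Suc m). g (label v)) =
      (\<Sum>v\<in>sphere (Suc n + m). \<Sum>u\<in>children v. g (label u))"
    using sum_sphere_Suc[of "\<lambda>v. g (label v)" "Suc n + m"] by simp
  also have "\<dots> = (\<Sum>v\<in>sphere (Suc n + m). transfer g (label v))"
    by (intro sum.cong refl sum_children_label) (auto dest: sphere_V sphere_Suc_not_root)
  also have "\<dots> = (\<Sum>v\<in>sphere (Suc n). (transfer ^^ Suc m) g (label v))"
    by (simp only: Suc funpow_Suc_right comp_apply)
  finally show ?case .
qed simp

text \<open>Only levels from 1 on occur, where every vertex has two children and
  \<open>transfer\<close> applies.\<close>

lemma sum_excess_code_recurrence:
  "sum (excess code) (sphere (n + 7)) = sum (excess code) (sphere (n + 3))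
    + 4 * sum (excess code) (sphere (n + 2)) - 4 * sum (excess code) (sphere (n + 1))"
proof -
  have e: "sum (excess code) (sphere (Suc n + m)) =
      (\<Sum>v\<in>sphere (Suc n). (transfer ^^ m) label_excess (label v))" for m
    unfolding sum_sphere_transfer[symmetric]
    by (intro sum.cong refl) (auto simp: excess_def label_excess_def code_def dest: sphere_V)
  have idx: "n + 7 = Suc n + 6" "n + 3 = Suc n + 2" "n + 2 = Suc n + 1" "n + 1 = Suc n + 0"
    by simp_all
  show ?thesis
    unfolding idx e
    by (simp add: transfer_label_excess sum.distrib sum_subtractf sum_distrib_left)
qed

text \<open>After the triangle inequality a positive rate x works once
  \<open>x\<^sup>2 + 4 * x + 4 \<le> x ^ 6\<close>, that is, \<open>x + 2 \<le> x ^ 3\<close>. The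
  value 5/3 satisfies this and is below the growth rate 2 of the spheres.\<close>

lemma sum_excess_code_sphere_bound:
  obtains K where "K \<ge> 0" "\<And>n. \<bar>sum (excess code) (sphere n)\<bar> \<le> K * (5 / 3) ^ n"
proof -
  define e where "e n = sum (excess code) (sphere n)" for n
  \<comment> \<open>Covers the seven levels before the recurrence starts.\<close>
  define K where "K = (\<Sum>n<7. \<bar>e n\<bar>)"
  have K: "K \<ge> 0" unfolding K_def by (intro sum_nonneg) simp
  have "\<bar>e n\<bar> \<le> K * (5 / 3) ^ n" for n
  proof (induction n rule: less_induct)
    case (less n)
    show ?case
    proof (cases "n < 7")
      case True
      then have "\<bar>e n\<bar> \<le> K" unfolding K_def by (intro member_le_sum) auto
      also have "K * 1 \<le> K * (5 / 3) ^ n" using K by (intro mult_left_mono one_le_power) auto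
      finally show ?thesis by simp
    next
      case False
      define m where "m = n - 7"
      have n: "n = m + 7" using False by (simp add: m_def)
      have "\<bar>e n\<bar> \<le> \<bar>e (m + 3)\<bar> + 4 * \<bar>e (m + 2)\<bar> + 4 * \<bar>e (m + 1)\<bar>"
        using sum_excess_code_recurrence[of m] unfolding n e_def by linarith
      also have "\<dots> \<le> K * (5 / 3) ^ (m + 3) + 4 * (K * (5 / 3) ^ (m + 2)) + 4 * (K * (5 / 3) ^ (m + 1))"
        using less[of "m + 3"] less[of "m + 2"] less[of "m + 1"] n by linarith
      also have "\<dots> = (K * (5 / 3) ^ m) * ((5 / 3) ^ 3 + 4 * (5 / 3) ^ 2 + 4 * (5 / 3))"
        by (simp add: power_add power2_eq_square power3_eq_cube algebra_simps)
      also have "\<dots> \<le> (K * (5 / 3) ^ m) * (5 / 3) ^ 7"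
        using K by (intro mult_left_mono) (auto simp: power_divide)
      finally show ?thesis by (simp add: n power_add mult.assoc)
    qed
  qed
  then show thesis using that K unfolding e_def by blast
qed

lemma upper_density_code: "upper_density V E v0 code = ereal (4 / 7)"
proof -
  obtain K where K: "K \<ge> 0" "\<And>n. \<bar>sum (excess code) (sphere n)\<bar> \<le> K * (5 / 3) ^ n"
    using sum_excess_code_sphere_bound by blast
  \<comment> \<open>5/2 = 1 / (1 - 3/5) sums the geometric series of sphere bounds.\<close>
  have Y: "\<bar>sum (excess code) (ball r)\<bar> \<le> 5 / 2 * (K * (5 / 3) ^ r)" for r
  proof (induction r)
    case 0
    then show ?case using K(1) K(2)[of 0] by (simp add: sum_ball)
  next
    case (Suc r)
    have "sum (excess code) (ball (Suc r)) = sum (excess code) (ball r) + sum (excess code) (sphere (Suc r))"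
      by (simp add: sum_ball)
    moreover have "K * (5 / 3) ^ Suc r = 5 / 3 * (K * (5 / 3) ^ r)" by simp
    ultimately show ?case using Suc K(2)[of "Suc r"] by linarith
  qed
  let ?d = "\<lambda>r. real (card (code \<inter> ball r)) / real (card (ball r))"
  \<comment> \<open>Dividing by a ball size of at least \<open>2 ^ r\<close> turns the rate 5/3 into
    5/6.\<close>
  have bound: "\<bar>?d r - 4 / 7\<bar> \<le> 5 / 2 * K * (5 / 6) ^ r" for r
  proof -
    have pos: "0 < real (card (ball r))"
      using card_ball_bounds(1)[of r] by (meson less_le_trans zero_less_numeral zero_less_power)
    then have "?d r - 4 / 7 = sum (excess code) (ball r) / (7 * real (card (ball r)))"
      by (simp add: sum_excess_ball field_simps)
    then have "\<bar>?d r - 4 / 7\<bar> = \<bar>sum (excess code) (ball r)\<bar> / (7 * real (card (ball r)))"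
      using pos by (simp add: abs_divide)
    also have "\<dots> \<le> 5 / 2 * (K * (5 / 3) ^ r) / 2 ^ r"
    proof (intro frac_le)
      show "2 ^ r \<le> 7 * real (card (ball r))" using card_ball_bounds(1)[of r] by linarith
    qed (use Y[of r] K(1) in simp_all)
    also have "\<dots> = 5 / 2 * K * (5 / 6) ^ r"
      using power_mult_distrib[of "3 :: real" 2 r] by (simp add: power_divide mult.assoc)
    finally show ?thesis .
  qed
  have "(\<lambda>r. 5 / 2 * K * (5 / 6) ^ r) \<longlonglongrightarrow> 5 / 2 * K * 0"
    by (intro tendsto_mult tendsto_const LIMSEQ_realpow_zero) auto
  then have lim: "(\<lambda>r. 5 / 2 * K * (5 / 6) ^ r) \<longlonglongrightarrow> 0" by simp
  have "(\<lambda>r. ?d r - 4 / 7) \<longlonglongrightarrow> 0"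
    by (rule tendsto_0_le[OF lim, where K = 1]) (use bound K(1) in \<open>simp add: abs_mult\<close>)
  then have "?d \<longlonglongrightarrow> 4 / 7" by (rule LIM_zero_cancel)
  then have "(\<lambda>r. ereal (?d r)) \<longlonglongrightarrow> ereal (4 / 7)" by simp
  then show ?thesis
    unfolding upper_density_def by (intro lim_imp_Limsup) simp_all
qed

end

theorem theorem12:
  fixes V :: "'a set" and E :: "('a \<times> 'a) set" and v0 :: 'a
  assumes "cubic_tree V E" and "v0 \<in> V"
  shows "red_ic_density V E v0 = ereal (4 / 7)"
proof -
  interpret rooted_cubic_tree V E v0 using assms by unfold_locales
  show ?thesis
    unfolding red_ic_density_def
  proof (rule antisym)
    show "(INF S\<in>{S. red_ic V E S}. upper_density V E v0 S) \<le> ereal (4 / 7)"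
      using red_ic_code upper_density_code by (metis INF_lower mem_Collect_eq)
    show "ereal (4 / 7) \<le> (INF S\<in>{S. red_ic V E S}. upper_density V E v0 S)"
      using upper_density_ge by (intro INF_greatest) simp
  qed
qed

end
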